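(* For every positive integer $n$ and every $1\le i\le n$, the statistic $\sigma\mapsto\#\{j>i:\sigma_j<\sigma_i\}$ (the number of inversions starting at the $i$-th entry) on $S_n$ is $\frac{n-i}{2}$-mesic with respect to the Lehmer code rotation.
   Context: A statistic $f$ is $c$-mesic with respect to a bijection $\mathcal{X}$ of a finite set if its average over every orbit of $\mathcal{X}$ equals $c$. Lehmer code: $L(\sigma)_i=\#\{j>i:\sigma_j<\sigma_i\}\in\{0,\dots,n-i\}$, a bijection from $S_n$ to such tuples. The Lehmer code rotation sends $\sigma$ to the unique $\tau$ with $L(\tau)_i\equiv L(\sigma)_i+1\pmod{n-i+1}$ for all $i$. *)

theory Defs
  imports Complex_Main "HOL-Combinatorics.Combinatorics" "HOL-Number_Theory.Cong"
begin

text \<open>The orbit of \<open>x\<close> is \<open>{(X ^^ k) x | k. 0 < k}\<close>; it contains \<open>x\<close> because \<open>X\<close> is required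
  to be a bijection of the finite set \<open>S\<close>.\<close>

definition mesic :: "'a set \<Rightarrow> ('a \<Rightarrow> 'a) \<Rightarrow> ('a \<Rightarrow> real) \<Rightarrow> real \<Rightarrow> bool" where
  "mesic S X f c \<longleftrightarrow> finite S \<and> bij_betw X S S \<and>
     (\<forall>x\<in>S. (\<Sum>y\<in>orbit X x. f y) / real (card (orbit X x)) = c)"

definition Sym :: "nat \<Rightarrow> (nat \<Rightarrow> nat) set" where
  "Sym n = {\<sigma>. \<sigma> permutes {1..n}}"

definition lehmer_code :: "nat \<Rightarrow> (nat \<Rightarrow> nat) \<Rightarrow> nat \<Rightarrow> nat" where
  "lehmer_code n \<sigma> i = card {j \<in> {1..n}. j > i \<and> \<sigma> j < \<sigma> i}"

definition lehmer_rotation :: "nat \<Rightarrow> (nat \<Rightarrow> nat) \<Rightarrow> (nat \<Rightarrow> nat)" where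
  "lehmer_rotation n \<sigma> = (THE \<tau>. \<tau> \<in> Sym n \<and>
     (\<forall>i\<in>{1..n}. [lehmer_code n \<tau> i = lehmer_code n \<sigma> i + 1] (mod (n - i + 1))))"

text \<open>The Lehmer code is a bijection onto the tuples with \<open>i\<close>-th entry in \<open>{0..n - i}\<close>, so the
  definite description above is well defined.\<close>

lemma lehmer_code_le: "lehmer_code n \<sigma> i \<le> n - i"
proof -
  have "lehmer_code n \<sigma> i \<le> card {i<..n}"
    unfolding lehmer_code_def by (rule card_mono) auto
  then show ?thesis by simp
qed

lemma lehmer_code_alt:
  assumes "\<sigma> \<in> Sym n" "i \<in> {1..n}"
  shows "lehmer_code n \<sigma> i = card {v \<in> {1..n} - \<sigma> ` {1..<i}. v < \<sigma> i}"
proof -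
  have perm: "\<sigma> permutes {1..n}" using assms by (simp add: Sym_def)
  have inj: "inj \<sigma>" using permutes_inj[OF perm] .
  have "{v \<in> {1..n} - \<sigma> ` {1..<i}. v < \<sigma> i} = \<sigma> ` {j \<in> {1..n}. j > i \<and> \<sigma> j < \<sigma> i}"
  proof (intro equalityI subsetI)
    fix v assume v: "v \<in> {v \<in> {1..n} - \<sigma> ` {1..<i}. v < \<sigma> i}"
    then obtain j where j: "j \<in> {1..n}" "v = \<sigma> j"
      using permutes_image[OF perm] by blast
    with v have "\<not> j < i" "j \<noteq> i" by auto
    with v j show "v \<in> \<sigma> ` {j \<in> {1..n}. j > i \<and> \<sigma> j < \<sigma> i}" by auto
  next
    fix v assume "v \<in> \<sigma> ` {j \<in> {1..n}. j > i \<and> \<sigma> j < \<sigma> i}"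
    then obtain j where j: "j \<in> {1..n}" "j > i" "\<sigma> j < \<sigma> i" "v = \<sigma> j" by blast
    have "v \<in> {1..n}" using j permutes_in_image[OF perm] by blast
    moreover have "v \<notin> \<sigma> ` {1..<i}" using j inj by (auto simp: inj_eq)
    ultimately show "v \<in> {v \<in> {1..n} - \<sigma> ` {1..<i}. v < \<sigma> i}" using j by simp
  qed
  then show ?thesis
    unfolding lehmer_code_def using inj by (simp add: card_image inj_on_subset)
qed

lemma lehmer_code_inj:
  assumes s: "\<sigma> \<in> Sym n" and t: "\<tau> \<in> Sym n"
    and eq: "\<And>i. i \<in> {1..n} \<Longrightarrow> lehmer_code n \<sigma> i = lehmer_code n \<tau> i"
  shows "\<sigma> = \<tau>"
proof -
  have aux: False
    if s: "\<sigma> \<in> Sym n" and t: "\<tau> \<in> Sym n" and i: "i \<in> {1..n}"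
      and eq: "lehmer_code n \<sigma> i = lehmer_code n \<tau> i"
      and IH: "\<sigma> ` {1..<i} = \<tau> ` {1..<i}" and less: "\<sigma> i < \<tau> i" for \<sigma> \<tau> i
  proof -
    have perm: "\<sigma> permutes {1..n}" using s by (simp add: Sym_def)
    have "\<sigma> i \<in> {1..n}" using permutes_in_image[OF perm] i by blast
    moreover have "\<sigma> i \<notin> \<sigma> ` {1..<i}" by (auto simp: inj_eq[OF permutes_inj[OF perm]])
    ultimately have "{v \<in> {1..n} - \<sigma> ` {1..<i}. v < \<sigma> i} \<subset> {v \<in> {1..n} - \<sigma> ` {1..<i}. v < \<tau> i}"
      using less by auto
    then have "card {v \<in> {1..n} - \<sigma> ` {1..<i}. v < \<sigma> i}
        < card {v \<in> {1..n} - \<sigma> ` {1..<i}. v < \<tau> i}"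
      by (rule psubset_card_mono[rotated]) simp
    then show False
      using eq lehmer_code_alt[OF s i] lehmer_code_alt[OF t i] IH by simp
  qed
  have "\<sigma> i = \<tau> i" if "i \<in> {1..n}" for i
    using that
  proof (induction i rule: less_induct)
    case (less i)
    have IH: "\<sigma> ` {1..<i} = \<tau> ` {1..<i}"
      by (rule image_cong) (use less in auto)
    show ?case
      using aux[OF s t less.prems eq[OF less.prems] IH]
        aux[OF t s less.prems eq[OF less.prems, symmetric] IH[symmetric]] by (meson linorder_neqE_nat)
  qed
  moreover have "\<sigma> i = \<tau> i" if "i \<notin> {1..n}" for i
    using that s t by (metis Sym_def mem_Collect_eq permutes_not_in)
  ultimately show ?thesis by blast
qed

lemma lehmer_code_bij:
  "bij_betw (\<lambda>\<sigma>. restrict (lehmer_code n \<sigma>) {1..n}) (Sym n) (PiE {1..n} (\<lambda>i. {0..n - i}))"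
proof -
  let ?L = "\<lambda>\<sigma>. restrict (lehmer_code n \<sigma>) {1..n}"
  let ?T = "PiE {1..n} (\<lambda>i. {0..n - i})"
  have inj: "inj_on ?L (Sym n)"
  proof (rule inj_onI, rule lehmer_code_inj)
    fix \<sigma> \<tau> i assume "?L \<sigma> = ?L \<tau>" "i \<in> {1..n}"
    then show "lehmer_code n \<sigma> i = lehmer_code n \<tau> i" by (metis restrict_apply')
  qed
  have "(\<Prod>i=1..n. Suc (n - i)) = (\<Prod>i=1..n. i)"
    by (rule prod.reindex_bij_witness[of _ "\<lambda>i. Suc n - i" "\<lambda>i. Suc n - i"]) auto
  then have "card ?T = fact n" by (simp add: card_PiE fact_prod)
  moreover have "card (Sym n) = fact n"
    unfolding Sym_def by (rule card_permutations) auto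
  moreover have "?L ` Sym n \<subseteq> ?T" using lehmer_code_le by auto
  moreover have "finite ?T" by (intro finite_PiE) auto
  ultimately have "?L ` Sym n = ?T"
    using card_image[OF inj] by (intro card_subset_eq) auto
  with inj show ?thesis by (simp add: bij_betw_def)
qed

lemma lehmer_rotation_ex1:
  "\<exists>!\<tau>. \<tau> \<in> Sym n \<and>
     (\<forall>i\<in>{1..n}. [lehmer_code n \<tau> i = lehmer_code n \<sigma> i + 1] (mod (n - i + 1)))"
proof (rule ex_ex1I)
  let ?g = "\<lambda>i\<in>{1..n}. (lehmer_code n \<sigma> i + 1) mod (n - i + 1)"
  have "?g i \<le> n - i" if "i \<in> {1..n}" for i
    using that mod_less_divisor[of "n - i + 1" "lehmer_code n \<sigma> i + 1"]
    by (simp add: less_Suc_eq_le del: mod_less_divisor)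
  then have "?g \<in> PiE {1..n} (\<lambda>i. {0..n - i})" by auto
  then obtain \<tau> where \<tau>: "\<tau> \<in> Sym n" "restrict (lehmer_code n \<tau>) {1..n} = ?g"
    using lehmer_code_bij[of n] by (smt (verit) bij_betw_imp_surj_on imageE)
  have "lehmer_code n \<tau> i = (lehmer_code n \<sigma> i + 1) mod (n - i + 1)" if "i \<in> {1..n}" for i
    using fun_cong[OF \<tau>(2), of i] that by simp
  with \<tau>(1) show "\<exists>\<tau>. \<tau> \<in> Sym n \<and>
     (\<forall>i\<in>{1..n}. [lehmer_code n \<tau> i = lehmer_code n \<sigma> i + 1] (mod (n - i + 1)))"
    by (auto simp: cong_def)
next
  fix \<tau> \<tau>'
  assume a: "\<tau> \<in> Sym n \<and>
     (\<forall>i\<in>{1..n}. [lehmer_code n \<tau> i = lehmer_code n \<sigma> i + 1] (mod (n - i + 1)))"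
    and b: "\<tau>' \<in> Sym n \<and>
     (\<forall>i\<in>{1..n}. [lehmer_code n \<tau>' i = lehmer_code n \<sigma> i + 1] (mod (n - i + 1)))"
  show "\<tau> = \<tau>'"
  proof (rule lehmer_code_inj)
    fix i assume "i \<in> {1..n}"
    with a b have "[lehmer_code n \<tau> i = lehmer_code n \<tau>' i] (mod (n - i + 1))"
      by (meson cong_sym cong_trans)
    moreover have "lehmer_code n \<tau> i < n - i + 1" "lehmer_code n \<tau>' i < n - i + 1"
      using lehmer_code_le[of n _ i] by (auto simp: less_Suc_eq_le)
    ultimately show "lehmer_code n \<tau> i = lehmer_code n \<tau>' i"
      by (simp add: cong_def)
  qed (use a b in auto)
qed

end

theory Submission
  imports Defs
begin

text \<open>Let \<open>m = n - i + 1\<close>. The rotation maps each orbit bijectively to itself and increases the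
  \<open>i\<close>-th code entry by one modulo \<open>m\<close>, so it carries the fibre of this entry over \<open>r\<close> onto the
  fibre over \<open>r + 1\<close>. All fibres within an orbit therefore have the same size, so the entry is
  equidistributed on \<open>{0..<m}\<close> and has mean \<open>(m - 1) / 2\<close>.\<close>

lemma orbit_subset_of_maps_to:
  assumes "X ` S \<subseteq> S" and "x \<in> S"
  shows "orbit X x \<subseteq> S"
proof
  fix y assume "y \<in> orbit X x"
  then show "y \<in> S" by induction (use assms in auto)
qed

text \<open>The step rule of \<open>orbit\<close> makes it closed under \<open>X\<close>, and an
  injective self-map of a finite set is onto.\<close>

lemma orbit_image_eq_of_inj_on:
  assumes "finite (orbit X x)" and "inj_on X (orbit X x)"
  shows "X ` orbit X x = orbit X x"
  by (rule endo_inj_surj) (use assms in \<open>auto intro: orbit.step\<close>)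

text \<open>Doubling the sum keeps the mean value formula within the natural numbers.\<close>

lemma sum_of_cyclic_shift:
  fixes g :: "'a \<Rightarrow> nat"
  assumes fin: "finite A" and bij: "bij_betw X A A"
    and less: "\<And>y. y \<in> A \<Longrightarrow> g y < m"
    and shift: "\<And>y. y \<in> A \<Longrightarrow> g (X y) = (g y + 1) mod m"
  shows "2 * (\<Sum>y\<in>A. g y) = card A * (m - 1)"
proof -
  define F where "F r = {y \<in> A. g y = r}" for r
  have img: "X ` A = A" and inj: "inj_on X A" using bij by (auto simp: bij_betw_def)
  have F_Suc: "F (Suc r) = X ` F r" if "Suc r < m" for r
  proof (intro equalityI subsetI)
    fix y assume y: "y \<in> F (Suc r)"
    then obtain z where z: "z \<in> A" "y = X z" using img by (auto simp: F_def)
    then have "(g z + 1) mod m = Suc r" using y shift by (simp add: F_def)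
    \<comment> \<open>If \<open>g z + 1 = m\<close>, the residue would be 0 rather than
      \<open>Suc r\<close>; otherwise no reduction takes place.\<close>
    then have "g z = r" using less[OF z(1)] by (cases "g z + 1 = m") auto
    then show "y \<in> X ` F r" using z by (auto simp: F_def)
  next
    fix y assume "y \<in> X ` F r"
    then obtain z where z: "z \<in> A" "g z = r" "y = X z" by (auto simp: F_def)
    then show "y \<in> F (Suc r)" using that shift[OF z(1)] img by (auto simp: F_def)
  qed
  have card_F: "card (F r) = card (F 0)" if "r < m" for r
    using that
  proof (induction r)
    case (Suc r)
    have "inj_on X (F r)" using inj by (rule inj_on_subset) (auto simp: F_def)
    then show ?case using Suc by (simp add: F_Suc card_image)
  qed simp
  \<comment> \<open>The weight \<open>h\<close> is kept general: the constant 1 will count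
    \<open>A\<close>, and the identity will sum \<open>g\<close>.\<close>
  have group: "(\<Sum>y\<in>A. h (g y)) = (\<Sum>r<m. card (F 0) * h r)" for h :: "nat \<Rightarrow> nat"
  proof -
    have "(\<Sum>y\<in>A. h (g y)) = (\<Sum>r<m. \<Sum>y\<in>F r. h (g y))"
      unfolding F_def by (rule sum.group[symmetric]) (use fin less in auto)
    also have "\<dots> = (\<Sum>r<m. card (F r) * h r)"
      by (rule sum.cong) (simp_all add: F_def)
    also have "\<dots> = (\<Sum>r<m. card (F 0) * h r)"
      by (rule sum.cong[OF refl], subst card_F) simp_all
    finally show ?thesis .
  qed
  have "card A = m * card (F 0)" using group[of "\<lambda>_. 1"] by simp
  moreover have "(\<Sum>y\<in>A. g y) = card (F 0) * (\<Sum>r<m. r)"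
    using group[of "\<lambda>r. r"] by (simp add: sum_distrib_left)
  moreover have "2 * (\<Sum>r<m. r) = m * (m - 1)"
    by (induction m) (auto simp: algebra_simps split: nat_diff_split)
  ultimately show ?thesis by (simp add: mult.left_commute[of 2] mult.commute)
qed

lemma mesic_of_cyclic_shift:
  fixes g :: "'a \<Rightarrow> nat"
  assumes fin: "finite S" and bij: "bij_betw X S S" and m: "m > 0"
    and less: "\<And>y. y \<in> S \<Longrightarrow> g y < m"
    and shift: "\<And>y. y \<in> S \<Longrightarrow> g (X y) = (g y + 1) mod m"
  shows "mesic S X (\<lambda>y. real (g y)) ((real m - 1) / 2)"
  unfolding mesic_def
proof (intro conjI ballI fin bij)
  fix x assume x: "x \<in> S"
  have sub: "orbit X x \<subseteq> S"
    by (rule orbit_subset_of_maps_to) (use bij x in \<open>auto simp: bij_betw_def\<close>)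
  have fin_orbit: "finite (orbit X x)" using finite_subset[OF sub fin] .
  have inj: "inj_on X (orbit X x)"
    using bij sub by (auto simp: bij_betw_def intro: inj_on_subset)
  have "2 * (\<Sum>y\<in>orbit X x. g y) = card (orbit X x) * (m - 1)"
    by (rule sum_of_cyclic_shift[OF fin_orbit])
      (use orbit_image_eq_of_inj_on[OF fin_orbit inj] inj sub less shift
        in \<open>auto simp: bij_betw_def\<close>)
  then have "real (2 * (\<Sum>y\<in>orbit X x. g y)) = real (card (orbit X x) * (m - 1))"
    by (rule arg_cong)
  \<comment> \<open>Since \<open>m > 0\<close>, the truncated difference \<open>m - 1\<close> agrees
    with the real one.\<close>
  then have "2 * (\<Sum>y\<in>orbit X x. real (g y)) = real (card (orbit X x)) * (real m - 1)"
    using m by simp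
  \<comment> \<open>The orbit contains \<open>X x\<close>, so dividing by its size is
    legitimate.\<close>
  moreover have "card (orbit X x) \<noteq> 0"
    using fin_orbit orbit.base[of X x] by auto
  ultimately show "(\<Sum>y\<in>orbit X x. real (g y)) / real (card (orbit X x)) = (real m - 1) / 2"
    by (simp add: field_simps)
qed

lemma lehmer_rotation_in_Sym: "lehmer_rotation n \<sigma> \<in> Sym n"
  using theI'[OF lehmer_rotation_ex1[of n \<sigma>]] unfolding lehmer_rotation_def by blast

text \<open>A code entry at \<open>i\<close> is at most \<open>n - i\<close>, hence its own residue,
  which turns the defining congruence into an equation.\<close>

lemma lehmer_code_rotation:
  assumes "i \<in> {1..n}"
  shows "lehmer_code n (lehmer_rotation n \<sigma>) i = (lehmer_code n \<sigma> i + 1) mod (n - i + 1)"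
proof -
  have "[lehmer_code n (lehmer_rotation n \<sigma>) i = lehmer_code n \<sigma> i + 1] (mod (n - i + 1))"
    using theI'[OF lehmer_rotation_ex1[of n \<sigma>]] assms unfolding lehmer_rotation_def by blast
  then show ?thesis
    using lehmer_code_le[of n "lehmer_rotation n \<sigma>" i] by (simp add: cong_def)
qed

lemma finite_Sym: "finite (Sym n)"
  unfolding Sym_def by (rule finite_permutations) simp

text \<open>Cancelling the added 1 shows that equal images have congruent codes; entries below the
  modulus are then equal, and the code determines the permutation. Finiteness of
  \<open>Sym n\<close> gives surjectivity.\<close>

lemma bij_betw_lehmer_rotation: "bij_betw (lehmer_rotation n) (Sym n) (Sym n)"
proof -
  have inj: "inj_on (lehmer_rotation n) (Sym n)"
  proof (rule inj_onI, rule lehmer_code_inj)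
    fix \<sigma> \<tau> i assume eq: "lehmer_rotation n \<sigma> = lehmer_rotation n \<tau>" and i: "i \<in> {1..n}"
    have "[lehmer_code n \<sigma> i + 1 = lehmer_code n \<tau> i + 1] (mod (n - i + 1))"
      using lehmer_code_rotation[OF i, of \<sigma>] lehmer_code_rotation[OF i, of \<tau>] eq
      by (simp add: cong_def)
    then have "[lehmer_code n \<sigma> i = lehmer_code n \<tau> i] (mod (n - i + 1))"
      by (simp only: cong_add_rcancel_nat)
    then show "lehmer_code n \<sigma> i = lehmer_code n \<tau> i"
      using lehmer_code_le[of n \<sigma> i] lehmer_code_le[of n \<tau> i] by (simp add: cong_def)
  qed
  moreover have "lehmer_rotation n ` Sym n = Sym n"
    by (rule endo_inj_surj[OF finite_Sym _ inj]) (use lehmer_rotation_in_Sym in auto)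
  ultimately show ?thesis by (simp add: bij_betw_def)
qed

theorem theorem4p14:
  fixes n i :: nat
  assumes "n \<ge> 1" and "1 \<le> i" and "i \<le> n"
  shows "mesic (Sym n) (lehmer_rotation n)
           (\<lambda>\<sigma>. real (card {j \<in> {1..n}. j > i \<and> \<sigma> j < \<sigma> i}))
           ((real n - real i) / 2)"
proof -
  have "mesic (Sym n) (lehmer_rotation n) (\<lambda>\<sigma>. real (lehmer_code n \<sigma> i))
          ((real (n - i + 1) - 1) / 2)"
  proof (rule mesic_of_cyclic_shift[OF finite_Sym bij_betw_lehmer_rotation])
    show "lehmer_code n \<sigma> i < n - i + 1" for \<sigma>
      using lehmer_code_le[of n \<sigma> i] by simp
    show "lehmer_code n (lehmer_rotation n \<sigma>) i = (lehmer_code n \<sigma> i + 1) mod (n - i + 1)" for \<sigma>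
      by (rule lehmer_code_rotation) (use assms in auto)
  qed simp
  \<comment> \<open>Because \<open>i \<le> n\<close>, \<open>real (n - i + 1) - 1\<close> equals
    \<open>real n - real i\<close>.\<close>
  then show ?thesis
    using assms by (simp add: lehmer_code_def)
qed

end
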